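(* Let $G$ be a finite connected graph. There exist an alphabet $\mathcal{A}=\mathcal{A}(G)\subset\mathcal{C}\times\mathcal{P}\times\mathcal{P}^{\mathcal{P}}$, an inclusion (injective map) $i:\mathcal{C}\to\mathcal{C}\times\mathcal{P}\times\mathcal{P}^{\mathcal{P}}$, and a transitive $0$-$1$ matrix $T=T(G)$ indexed by $\mathcal{A}$ such that for each $m\ge1$, the set $\Omega^{\rm L}_{1,m}$ is in one-to-one correspondence with the set of sequences $$\overline{\Omega}^{\rm L}_{1,m}:=\{\omega=(\omega_1,\dots,\omega_m)\in\mathcal{A}^{\{1,\dots,m\}}:\ \omega_1\in i(\mathcal{C}),\ T(\omega_k,\omega_{k+1})=1,\ k=1,\dots,m-1\}.$$ The correspondence is given by the projection $P:\mathcal{C}\times\mathcal{P}\times\mathcal{P}^{\mathcal{P}}\to\mathcal{C}$ onto the first coordinate, applied coordinatewise; that is, $\omega\mapsto(P(\omega_1),\dots,P(\omega_m))$ is a bijection from $\overline{\Omega}^{\rm L}_{1,m}$ onto $\Omega^{\rm L}_{1,m}$.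
   Context: Let $\deg_G(x)$ be the degree of $x$ in the finite connected graph $G$, and $m(x):=\deg_G(x)+2$. The graph $\Lambda=G\times\mathbb{Z}$ has an edge between $(x,k)$ and $(y,\ell)$ iff either $x\sim y$ in $G$ and $k=\ell$, or $x=y$ and $|k-\ell|=1$. $\Lambda_{n,m}$ is the subgraph induced on $G\times\{n,\dots,m\}$; similarly $\Lambda_{-\infty,m}$ and $\Lambda_{n,\infty}$. The rung at $k$ is $G\times\{k\}$. Set $\Delta_{uu}=m(x)$ for $u=(x,k)$ and $S_V=\prod_{u\in V}\{1,\dots,\Delta_{uu}\}$. For finite $V\subset\Lambda$, $V^-$ is the connected component of $\Lambda\setminus V$ containing $\Lambda_{-\infty,k}$ for some $k$, and $\partial_0^{\rm L}V$ is the set of $v\in V$ having a neighbour in $V^-$. A configuration $\eta\in S_V$ is left-burnable if there is an enumeration $v_1,\dots,v_{|V|}$ of $V$ such that for each $i$, with $V_i:=V\setminus\{v_1,\dots,v_{i-1}\}$: (i) $v_i\in\partial_0^{\rm L}V_i$; (ii) $\eta(v_i)>\Delta_{v_iv_i}-|\{u\in V_i^-:u\sim v_i\}|$. $\Omega^{\rm L}_{n,m}$ is the set of left-burnable configurations on $\Lambda_{n,m}$. $\mathcal{C}=\mathcal{C}(G):=\Omega^{\rm L}_{0,0}$ is the set of left-burnable configurations on a single rung, regarded as a set of configurations on any particular rung. The restriction of a left-burnable configuration to any rung is in $\mathcal{C}$, so elements of $\Omega^{\rm L}_{1,m}$ are identified with sequences of $m$ rungs in $\mathcal{C}^m$. $\mathcal{P}=\mathcal{P}(G)$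 is the set of all subsets of (the vertex set of) $G$, and $\mathcal{P}^{\mathcal{P}}$ is the set of functions $\mathcal{P}\to\mathcal{P}$. A $0$-$1$ matrix $T$ is transitive if some positive power of $T$ has all entries positive. *)

theory Defs
  imports "HOL-Library.FuncSet" "Graph_Theory.Graph_Theory"
begin

definition ladder :: "'a pair_pre_digraph \<Rightarrow> ('a \<times> int) pair_pre_digraph" where
  "ladder G = \<lparr> pverts = pverts G \<times> UNIV,
     parcs = {((x, k), (y, l)). x \<in> pverts G \<and> y \<in> pverts G \<and>
               ((x, y) \<in> parcs G \<and> k = l \<or> x = y \<and> \<bar>k - l\<bar> = 1)} \<rparr>"

definition slab :: "'a pair_pre_digraph \<Rightarrow> int \<Rightarrow> int \<Rightarrow> ('a \<times> int) set" where
  "slab G n m = pverts G \<times> {n..m}"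

definition left_half :: "'a pair_pre_digraph \<Rightarrow> int \<Rightarrow> ('a \<times> int) set" where
  "left_half G k = pverts G \<times> {..k}"

definition toppling_threshold :: "'a pair_pre_digraph \<Rightarrow> 'a \<times> int \<Rightarrow> nat" where
  "toppling_threshold G u = out_degree (with_proj G) (fst u) + 2"

definition stable_configs :: "'a pair_pre_digraph \<Rightarrow> ('a \<times> int) set \<Rightarrow> ('a \<times> int \<Rightarrow> nat) set" where
  "stable_configs G V = (\<Pi>\<^sub>E u\<in>V. {1..toppling_threshold G u})"

text \<open>
  All graphs here are symmetric, so strongly connected components are the connected components.
  The description below is proper (there is exactly one such component) when \<open>G\<close> is a connected
  graph and \<open>V\<close> is finite.
\<close>

definition left_component :: "'a pair_pre_digraph \<Rightarrow> ('a \<times> int) set \<Rightarrow> ('a \<times> int) set" where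
  "left_component G V =
     (THE C. C \<in> pre_digraph.sccs_verts
                   (with_proj (ladder G) \<restriction> (pverts (ladder G) - V)) \<and>
             (\<exists>k. left_half G k \<subseteq> C))"

definition left_boundary :: "'a pair_pre_digraph \<Rightarrow> ('a \<times> int) set \<Rightarrow> ('a \<times> int) set" where
  "left_boundary G V = {v \<in> V. \<exists>u \<in> left_component G V. (u, v) \<in> parcs (ladder G)}"

text \<open>
  The enumeration is indexed from \<open>0\<close>, so \<open>V - set (take i vs)\<close> is what remains when
  \<open>vs ! i\<close> is about to be burnt.
\<close>

definition left_burnable ::
    "'a pair_pre_digraph \<Rightarrow> ('a \<times> int) set \<Rightarrow> ('a \<times> int \<Rightarrow> nat) \<Rightarrow> bool" where
  "left_burnable G V \<eta> \<longleftrightarrow>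
     (\<exists>vs. distinct vs \<and> set vs = V \<and>
        (\<forall>i < length vs. let v = vs ! i; W = V - set (take i vs) in
           v \<in> left_boundary G W \<and>
           int (\<eta> v) > int (toppling_threshold G v) -
             int (card {u \<in> left_component G W. (u, v) \<in> parcs (ladder G)})))"

definition Omega_L :: "'a pair_pre_digraph \<Rightarrow> int \<Rightarrow> int \<Rightarrow> ('a \<times> int \<Rightarrow> nat) set" where
  "Omega_L G n m = {\<eta> \<in> stable_configs G (slab G n m). left_burnable G (slab G n m) \<eta>}"

definition rung_configs :: "'a pair_pre_digraph \<Rightarrow> ('a \<Rightarrow> nat) set" where
  "rung_configs G = (\<lambda>\<eta>. \<lambda>x\<in>pverts G. \<eta> (x, 0)) ` Omega_L G 0 0"

text \<open>The configuration on rungs \<open>1, \<dots>, m\<close> whose restriction to rung \<open>k\<close> is \<open>c k\<close>.\<close>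

definition config_of_rungs ::
    "'a pair_pre_digraph \<Rightarrow> int \<Rightarrow> (int \<Rightarrow> 'a \<Rightarrow> nat) \<Rightarrow> ('a \<times> int \<Rightarrow> nat)" where
  "config_of_rungs G m c = (\<lambda>(x, k)\<in>slab G 1 m. c k x)"

type_synonym 'a state = "('a \<Rightarrow> nat) \<times> 'a set \<times> ('a set \<Rightarrow> 'a set)"

definition states :: "'a pair_pre_digraph \<Rightarrow> 'a state set" where
  "states G = rung_configs G \<times> Pow (pverts G) \<times> (Pow (pverts G) \<rightarrow>\<^sub>E Pow (pverts G))"

fun matrix_power :: "'s set \<Rightarrow> ('s \<Rightarrow> 's \<Rightarrow> nat) \<Rightarrow> nat \<Rightarrow> 's \<Rightarrow> 's \<Rightarrow> nat" where
  "matrix_power A T 0 a b = (if a = b then 1 else 0)"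
| "matrix_power A T (Suc n) a b = (\<Sum>c\<in>A. matrix_power A T n a c * T c b)"

definition zero_one_matrix :: "'s set \<Rightarrow> ('s \<Rightarrow> 's \<Rightarrow> nat) \<Rightarrow> bool" where
  "zero_one_matrix A T \<longleftrightarrow> (\<forall>a\<in>A. \<forall>b\<in>A. T a b \<in> {0, 1})"

definition transitive_matrix :: "'s set \<Rightarrow> ('s \<Rightarrow> 's \<Rightarrow> nat) \<Rightarrow> bool" where
  "transitive_matrix A T \<longleftrightarrow> (\<exists>n>0. \<forall>a\<in>A. \<forall>b\<in>A. matrix_power A T n a b > 0)"

definition admissible_seqs ::
    "'s set \<Rightarrow> 's set \<Rightarrow> ('s \<Rightarrow> 's \<Rightarrow> nat) \<Rightarrow> int \<Rightarrow> (int \<Rightarrow> 's) set" where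
  "admissible_seqs A I T m =
     {\<omega> \<in> {1..m} \<rightarrow>\<^sub>E A. \<omega> 1 \<in> I \<and> (\<forall>k\<in>{1..m - 1}. T (\<omega> k) (\<omega> (k + 1)) = 1)}"

end

theory Submission
  imports Defs
begin

text \<open>
  Burning from the left proceeds with the right half of the ladder unburnt until the fire touches
  the last rung; from then on the right half belongs to the left component as well. Hence a
  configuration on rungs \<open>1, \<dots>, m\<close> is left-burnable iff the fire from the left alone reaches rung
  \<open>m\<close>, and the fire from both sides burns everything. Both conditions can be read off from the maps
  \<open>f\<^sub>k\<close> sending a set \<open>X\<close> of burnt sites on rung \<open>k + 1\<close> to the sites on rung \<open>k\<close> that burn given
  the rungs \<open>1, \<dots>, k\<close>: they say \<open>f\<^sub>k({}) \<noteq> {}\<close> and \<open>f\<^sub>k(V) = V\<close> for all \<open>k\<close>. As \<open>f\<^sub>k\<close> is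
  determined by \<open>f\<^sub>k\<^sub>-\<^sub>1\<close> and the configuration on rung \<open>k\<close>, the pairs (rung, \<open>f\<^sub>k\<close>) are the states of
  a deterministic automaton; the component in \<open>\<P>\<close> of the alphabet is kept
  constant. The matrix is transitive because reading the maximal rung configuration leads from
  every state to one and the same state, from which every state can be reached.
\<close>

section \<open>Synchronizing 0-1 matrices\<close>

lemma matrix_power_Suc_pos:
  assumes "finite A" "c \<in> A" "matrix_power A T n a c > 0" "T c b > 0"
  shows "matrix_power A T (Suc n) a b > 0"
proof -
  have "0 < matrix_power A T n a c * T c b" using assms by simp
  also have "\<dots> \<le> matrix_power A T (Suc n) a b"
    using assms member_le_sum[of c A "\<lambda>c. matrix_power A T n a c * T c b"] by simp
  finally show ?thesis .
qed

text \<open>The recursion of \<open>matrix_power\<close> appends a step at the end of a walk;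
  prepending one takes an induction on the length.\<close>

lemma matrix_power_Suc_pos':
  assumes "finite A" "a \<in> A" "c \<in> A" "T a c > 0" "matrix_power A T n c b > 0"
  shows "matrix_power A T (Suc n) a b > 0"
  using assms(5)
proof (induction n arbitrary: b)
  case 0
  then have "b = c" by (simp split: if_splits)
  then show ?case using assms by (intro matrix_power_Suc_pos[of A a]) auto
next
  case (Suc n)
  then obtain d where "d \<in> A" "matrix_power A T n c d > 0" "T d b > 0"
    using assms(1) by (auto simp: sum_nonneg_eq_0_iff simp flip: neq0_conv)
  then show ?case using Suc.IH assms(1) by (blast intro: matrix_power_Suc_pos)
qed

text \<open>Applied to \<open>z\<close> itself, \<open>sync\<close> gives a loop, so a walk from
  \<open>z\<close> to \<open>b\<close> can be lengthened at will. Walks of one common length, the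
  maximum over the finite \<open>A\<close>, thus reach every \<open>b\<close>, and one more step in
  front leads from any \<open>a\<close> to \<open>z\<close>.\<close>

lemma transitive_matrixI:
  assumes fin: "finite A" and z: "z \<in> A" and sync: "\<And>a. a \<in> A \<Longrightarrow> T a z > 0"
    and reach: "\<And>b. b \<in> A \<Longrightarrow> \<exists>n. matrix_power A T n z b > 0"
  shows "transitive_matrix A T"
proof -
  obtain N where N: "matrix_power A T (N b) z b > 0" if "b \<in> A" for b
    using reach by metis
  have pump: "matrix_power A T (k + n) z b > 0" if "matrix_power A T n z b > 0" for k n b
    using that
  proof (induction k)
    case (Suc k)
    show ?case unfolding add_Suc
      by (rule matrix_power_Suc_pos'[where T = T, OF fin z z sync[OF z] Suc.IH[OF Suc.prems]])
  qed simp
  have "matrix_power A T (Suc (Max (N ` A))) a b > 0" if "a \<in> A" "b \<in> A" for a b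
  proof (rule matrix_power_Suc_pos'[where T = T, OF fin \<open>a \<in> A\<close> z sync[OF \<open>a \<in> A\<close>]])
    have "N b \<le> Max (N ` A)" using fin that by simp
    then show "matrix_power A T (Max (N ` A)) z b > 0"
      using pump[OF N[OF \<open>b \<in> A\<close>], of "Max (N ` A) - N b"] by simp
  qed
  then show ?thesis unfolding transitive_matrix_def by blast
qed

section \<open>The left component\<close>

text \<open>Strong connectivity of the induced subgraph, put in terms of a bare relation so that
  regions can be glued without digraph records.\<close>

definition joined :: "('v \<times> 'v) set \<Rightarrow> 'v set \<Rightarrow> bool" where
  "joined E K \<longleftrightarrow> (\<forall>u\<in>K. \<forall>v\<in>K. (u, v) \<in> (Restr E K)\<^sup>*)"

text \<open>\<open>a\<close> serves as a hub: every vertex of the union reaches it and is reached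
  from it, those outside \<open>K\<close> by way of \<open>b\<close>.\<close>

lemma joined_Un:
  assumes "joined E K" "joined E L" "sym E" "a \<in> K" "b \<in> L" "(a, b) \<in> E"
  shows "joined E (K \<union> L)"
proof -
  let ?R = "Restr E (K \<union> L)"
  have mono: "(Restr E K)\<^sup>* \<subseteq> ?R\<^sup>*" "(Restr E L)\<^sup>* \<subseteq> ?R\<^sup>*"
    by (intro rtrancl_mono; blast)+
  have ab: "(a, b) \<in> ?R" "(b, a) \<in> ?R"
    using assms by (auto dest: symD)
  have hub: "(u, a) \<in> ?R\<^sup>* \<and> (a, u) \<in> ?R\<^sup>*" if "u \<in> K \<union> L" for u
  proof (cases "u \<in> K")
    case True
    then show ?thesis using assms mono unfolding joined_def by blast
  next
    case False
    then have "(u, b) \<in> ?R\<^sup>*" "(b, u) \<in> ?R\<^sup>*"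
      using that assms mono unfolding joined_def by blast+
    then show ?thesis using ab
      by (meson converse_rtrancl_into_rtrancl rtrancl.rtrancl_into_rtrancl)
  qed
  then show ?thesis unfolding joined_def by (meson rtrancl_trans)
qed

locale connected_pair_graph = pair_graph G for G :: "'a pair_pre_digraph" +
  assumes connected: "connected (with_proj G)"
begin

abbreviation ladder_arcs where "ladder_arcs \<equiv> parcs (ladder G)"

abbreviation right_half :: "int \<Rightarrow> ('a \<times> int) set" where
  "right_half k \<equiv> pverts G \<times> {k..}"

lemma pverts_nonempty: "pverts G \<noteq> {}"
  using connected by (auto simp: connected_conv)

lemma base_reachable: "x \<in> pverts G \<Longrightarrow> y \<in> pverts G \<Longrightarrow> (x, y) \<in> (parcs G)\<^sup>*"
  using symmetric_connected_imp_strongly_connected[OF sym_arcs connected]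
  by (simp add: strongly_connected_def reachable_conv)

lemma ladder_arcs_iff:
  "((x, k), (y, l)) \<in> ladder_arcs \<longleftrightarrow> x \<in> pverts G \<and> y \<in> pverts G \<and>
     ((x, y) \<in> parcs G \<and> k = l \<or> x = y \<and> \<bar>k - l\<bar> = 1)"
  by (simp add: ladder_def)

lemma sym_ladder_arcs: "sym ladder_arcs"
  by (rule symI) (auto simp: ladder_arcs_iff arcs_symmetric abs_minus_commute)

text \<open>A walk inside one rung exists by connectedness of \<open>G\<close>; a vertical walk over
  a fixed vertex follows, and convexity of \<open>I\<close> keeps it inside.\<close>

lemma joined_interval:
  assumes "\<And>a b k. a \<in> I \<Longrightarrow> b \<in> I \<Longrightarrow> a \<le> k \<Longrightarrow> k \<le> b \<Longrightarrow> k \<in> I"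
  shows "joined ladder_arcs (pverts G \<times> I)"
proof -
  let ?R = "Restr ladder_arcs (pverts G \<times> I)"
  have symR: "sym (?R\<^sup>*)"
    using sym_ladder_arcs by (intro sym_rtrancl) (auto simp: sym_def)
  have up: "((x, a), (x, b)) \<in> ?R\<^sup>*" if "a \<le> b" "x \<in> pverts G" "a \<in> I" "b \<in> I" for x a b
    using that
  proof (induction b rule: int_ge_induct)
    case (step b)
    then have "b \<in> I" using assms[of a "b + 1" b] by simp
    moreover have "((x, b), (x, b + 1)) \<in> ?R"
      using step \<open>b \<in> I\<close> by (simp add: ladder_arcs_iff)
    ultimately show ?case using step by (meson rtrancl.rtrancl_into_rtrancl)
  qed simp
  have vert: "((x, a), (x, b)) \<in> ?R\<^sup>*" if "x \<in> pverts G" "a \<in> I" "b \<in> I" for x a b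
    using up[of a b x] up[of b a x] that symD[OF symR] by (cases "a \<le> b") auto
  have horiz: "((x, a), (y, a)) \<in> ?R\<^sup>*" if "x \<in> pverts G" "y \<in> pverts G" "a \<in> I" for x y a
    using base_reachable[OF that(1,2)]
  proof (induction rule: rtrancl_induct)
    case (step y z)
    then have "((y, a), (z, a)) \<in> ?R"
      using that by (auto simp: ladder_arcs_iff dest: wellformed')
    with step.IH show ?case by (rule rtrancl.rtrancl_into_rtrancl)
  qed simp
  show ?thesis unfolding joined_def
  proof (intro ballI)
    fix u v assume "u \<in> pverts G \<times> I" "v \<in> pverts G \<times> I"
    then have "(u, (fst v, snd u)) \<in> ?R\<^sup>*" "((fst v, snd u), v) \<in> ?R\<^sup>*"
      using horiz[of "fst u" "fst v" "snd u"] vert[of "fst v" "snd u" "snd v"] by auto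
    then show "(u, v) \<in> ?R\<^sup>*" by (rule rtrancl_trans)
  qed
qed

text \<open>This resolves the definite description. \<open>K\<close> is a component because it is
  joined and only arcs into \<open>W\<close> leave it. It is the only one containing a left half,
  since two such components overlap far to the left.\<close>

lemma left_component_eqI:
  assumes K: "K \<subseteq> pverts (ladder G) - W" "left_half G k \<subseteq> K" "joined ladder_arcs K"
    and closed: "\<And>u v. u \<in> K \<Longrightarrow> (u, v) \<in> ladder_arcs \<Longrightarrow> v \<notin> W \<Longrightarrow> v \<in> K"
  shows "left_component G W = K"
proof -
  let ?S = "pverts (ladder G) - W"
  let ?H = "with_proj (ladder G) \<restriction> ?S"
  interpret L: pair_wf_digraph "ladder G"
    by unfold_locales (auto simp: ladder_def)
  interpret H: wf_digraph ?H
    by (rule L.wellformed_induce_subgraph)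
  have ends: "arcs_ends ?H = Restr ladder_arcs ?S"
    by (force simp: arcs_ends_conv)
  have reach: "u \<rightarrow>\<^sup>*\<^bsub>?H\<^esub> v \<longleftrightarrow> (u, v) \<in> (Restr ladder_arcs ?S)\<^sup>* \<and> u \<in> ?S \<and> v \<in> ?S" for u v
    by (simp add: H.reachable_conv ends)
  have inK: "u \<rightarrow>\<^sup>*\<^bsub>?H\<^esub> v" if "u \<in> K" "v \<in> K" for u v
  proof -
    have "(u, v) \<in> (Restr ladder_arcs K)\<^sup>*" using K(3) that by (simp add: joined_def)
    then have "(u, v) \<in> (Restr ladder_arcs ?S)\<^sup>*"
      by (rule subsetD[OF rtrancl_mono, rotated]) (use K in blast)
    then show ?thesis using that K unfolding reach by blast
  qed
  have escape: "v \<in> K" if "u \<in> K" "u \<rightarrow>\<^sup>*\<^bsub>?H\<^esub> v" for u v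
  proof -
    have "(u, v) \<in> (Restr ladder_arcs ?S)\<^sup>*" using that unfolding reach by blast
    then show ?thesis using that(1) by induction (auto intro: closed)
  qed
  obtain x where x: "x \<in> pverts G" using pverts_nonempty by blast
  have K_scc: "K \<in> pre_digraph.sccs_verts ?H"
    unfolding pre_digraph.sccs_verts_def mem_Collect_eq
  proof (intro conjI)
    show "K \<noteq> {}" using K(2) x by (auto simp: left_half_def)
  qed (use inK escape in blast)+
  moreover have "C = K"
    if C: "C \<in> pre_digraph.sccs_verts ?H" "left_half G j \<subseteq> C" for C j
  proof -
    have "(x, min j k) \<in> C" "(x, min j k) \<in> K"
      using x K(2) C(2) by (auto simp: left_half_def)
    then show ?thesis
      using H.sccs_verts_disjoint[OF C(1) K_scc] by blast
  qed
  ultimately show ?thesis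
    unfolding left_component_def using K(2) by (intro the_equality) blast+
qed

text \<open>The left component after burning \<open>B\<close> on rungs \<open>a, \<dots>, m\<close>: a burnt site on rung \<open>m\<close> opens
  the right half.\<close>

definition burnt_region :: "int \<Rightarrow> int \<Rightarrow> ('a \<times> int) set \<Rightarrow> ('a \<times> int) set" where
  "burnt_region a m B = left_half G (a - 1) \<union> B \<union>
     (if B \<inter> pverts G \<times> {m} = {} then {} else right_half (m + 1))"

text \<open>The point is that no arc into a site outside \<open>slab G a m - B\<close> leaves the
  region. If nothing on rung \<open>m\<close> has burnt, the region stays strictly left of rung
  \<open>m\<close>, hence is not adjacent to the right half.\<close>

lemma left_component_eq_burnt_region:
  assumes "a \<le> m" "B \<subseteq> slab G a m" "joined ladder_arcs (burnt_region a m B)"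
  shows "left_component G (slab G a m - B) = burnt_region a m B"
proof (rule left_component_eqI)
  show "burnt_region a m B \<subseteq> pverts (ladder G) - (slab G a m - B)"
    using assms(1,2) by (auto simp: burnt_region_def left_half_def slab_def ladder_def split: if_splits)
  show "left_half G (a - 1) \<subseteq> burnt_region a m B"
    by (auto simp: burnt_region_def)
  fix u v
  assume uv: "u \<in> burnt_region a m B" "(u, v) \<in> ladder_arcs" "v \<notin> slab G a m - B"
  obtain x k y l where [simp]: "u = (x, k)" "v = (y, l)" by force
  show "v \<in> burnt_region a m B"
  proof (cases "B \<inter> pverts G \<times> {m} = {}")
    case True
    then have "k < m" if "(x, k) \<in> B"
      using that assms(2) by (force simp: slab_def)
    then show ?thesis
      using uv True assms(1)
      by (auto simp: burnt_region_def left_half_def slab_def ladder_arcs_iff)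
  next
    case False
    then show ?thesis
      using uv by (auto simp: burnt_region_def left_half_def slab_def ladder_arcs_iff)
  qed
qed (rule assms(3))

lemma joined_burnt_region_empty: "joined ladder_arcs (burnt_region a m {})"
proof -
  have "joined ladder_arcs (pverts G \<times> {..a - 1})"
    by (rule joined_interval) auto
  then show ?thesis by (simp add: burnt_region_def left_half_def)
qed

text \<open>The region grows by more than \<open>v\<close> only if \<open>v\<close> is the first
  burnt site on rung \<open>m\<close>; the right half is then attached through the arc from
  \<open>v\<close> to rung \<open>m + 1\<close>.\<close>

lemma joined_burnt_region_insert:
  assumes "joined ladder_arcs (burnt_region a m B)" "v \<in> pverts G \<times> UNIV"
    and "u \<in> burnt_region a m B" "(u, v) \<in> ladder_arcs"
  shows "joined ladder_arcs (burnt_region a m (insert v B))"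
proof -
  have single: "joined ladder_arcs {v}" by (simp add: joined_def)
  have 1: "joined ladder_arcs (burnt_region a m B \<union> {v})"
    using assms by (intro joined_Un[OF _ single sym_ladder_arcs]) auto
  show ?thesis
  proof (cases "snd v = m \<and> B \<inter> pverts G \<times> {m} = {}")
    case True
    have "(v, (fst v, m + 1)) \<in> ladder_arcs"
      using True assms(2) by (cases v) (auto simp: ladder_arcs_iff)
    moreover have "joined ladder_arcs (right_half (m + 1))"
      by (rule joined_interval) auto
    ultimately have "joined ladder_arcs ((burnt_region a m B \<union> {v}) \<union> right_half (m + 1))"
      using assms(2) by (intro joined_Un[OF 1 _ sym_ladder_arcs, of _ v]) auto
    moreover have "burnt_region a m (insert v B) = (burnt_region a m B \<union> {v}) \<union> right_half (m + 1)"
      using True assms(2) by (auto simp: burnt_region_def)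
    ultimately show ?thesis by simp
  next
    case False
    then have "burnt_region a m (insert v B) = burnt_region a m B \<union> {v}"
      using assms(2) by (auto simp: burnt_region_def)
    then show ?thesis using 1 by simp
  qed
qed

section \<open>Burning as a closure\<close>

text \<open>The burning inequality, rearranged so that natural numbers need not be
  subtracted.\<close>

definition hot :: "('a \<times> int \<Rightarrow> nat) \<Rightarrow> ('a \<times> int) set \<Rightarrow> 'a \<times> int \<Rightarrow> bool" where
  "hot \<eta> B v \<longleftrightarrow> toppling_threshold G v < \<eta> v + card {u \<in> B. (u, v) \<in> ladder_arcs}"

lemma finite_neighbours: "finite {u. (u, v) \<in> ladder_arcs}"
proof (rule finite_subset)
  show "{u. (u, v) \<in> ladder_arcs} \<subseteq> pverts G \<times> {snd v - 1..snd v + 1}"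
    by (cases v) (auto simp: ladder_arcs_iff)
  show "finite (pverts G \<times> {snd v - 1..snd v + 1})"
    using pair_finite_verts by simp
qed

text \<open>Only neighbours of \<open>v\<close> are compared, so the lemma also applies to sets that
  differ away from \<open>v\<close>.\<close>

lemma hot_mono:
  assumes "hot \<eta> B v" "\<And>u. (u, v) \<in> ladder_arcs \<Longrightarrow> u \<in> B \<Longrightarrow> u \<in> C"
  shows "hot \<eta> C v"
proof -
  have "card {u \<in> B. (u, v) \<in> ladder_arcs} \<le> card {u \<in> C. (u, v) \<in> ladder_arcs}"
    using assms(2) by (intro card_mono finite_subset[OF _ finite_neighbours[of v]]) auto
  then show ?thesis using assms(1) unfolding hot_def by linarith
qed

section \<open>Burning orders on a slab\<close>

lemma left_half_Un_slab: "a - 1 \<le> k \<Longrightarrow> left_half G k = left_half G (a - 1) \<union> slab G a k"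
  by (auto simp: left_half_def slab_def)

lemma finite_slab: "finite (slab G a k)"
  using pair_finite_verts by (simp add: slab_def)

text \<open>The order may stop before the slab is exhausted, which makes it possible to speak of
  orders of maximal length.\<close>

definition burning_order :: "('a \<times> int \<Rightarrow> nat) \<Rightarrow> int \<Rightarrow> int \<Rightarrow> ('a \<times> int) list \<Rightarrow> bool" where
  "burning_order \<eta> a m vs \<longleftrightarrow> distinct vs \<and> set vs \<subseteq> slab G a m \<and>
     (\<forall>i<length vs. hot \<eta> (burnt_region a m (set (take i vs))) (vs ! i))"

text \<open>At a stable value a site without burnt neighbours is never hot, so the boundary
  condition is implied by the inequality.\<close>

lemma burnable_next_iff_hot:
  assumes "a \<le> m" "B \<subseteq> slab G a m" "joined ladder_arcs (burnt_region a m B)"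
    and "v \<in> slab G a m - B" "\<eta> v \<le> toppling_threshold G v"
  shows "v \<in> left_boundary G (slab G a m - B) \<and>
      int (\<eta> v) > int (toppling_threshold G v) -
        int (card {u \<in> left_component G (slab G a m - B). (u, v) \<in> ladder_arcs})
    \<longleftrightarrow> hot \<eta> (burnt_region a m B) v"
proof -
  have "\<exists>u \<in> burnt_region a m B. (u, v) \<in> ladder_arcs" if "hot \<eta> (burnt_region a m B) v"
  proof (rule ccontr)
    assume "\<not> ?thesis"
    then have "{u \<in> burnt_region a m B. (u, v) \<in> ladder_arcs} = {}" by blast
    then have "card {u \<in> burnt_region a m B. (u, v) \<in> ladder_arcs} = 0" by (simp only: card.empty)
    then show False using that assms(5) unfolding hot_def by linarith
  qed
  moreover have "int (\<eta> v) > int (toppling_threshold G v) -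
        int (card {u \<in> burnt_region a m B. (u, v) \<in> ladder_arcs}) \<longleftrightarrow> hot \<eta> (burnt_region a m B) v"
    unfolding hot_def by linarith
  ultimately show ?thesis
    using assms(4) unfolding left_boundary_def left_component_eq_burnt_region[OF assms(1-3)]
    by blast
qed

text \<open>The left component is the burnt region only while that region is joined, and it stays
  joined only if each new site is attached to it. Joinedness is therefore carried along the
  enumeration together with the equivalence of the two burning conditions.\<close>

lemma left_burnable_iff_burning_order:
  assumes "a \<le> m" and stable: "\<And>v. v \<in> slab G a m \<Longrightarrow> \<eta> v \<le> toppling_threshold G v"
  shows "left_burnable G (slab G a m) \<eta> \<longleftrightarrow> (\<exists>vs. burning_order \<eta> a m vs \<and> set vs = slab G a m)"
proof -
  let ?P = "\<lambda>vs i. vs ! i \<in> left_boundary G (slab G a m - set (take i vs)) \<and>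
      int (\<eta> (vs ! i)) > int (toppling_threshold G (vs ! i)) -
        int (card {u \<in> left_component G (slab G a m - set (take i vs)). (u, vs ! i) \<in> ladder_arcs})"
  let ?Q = "\<lambda>vs i. hot \<eta> (burnt_region a m (set (take i vs))) (vs ! i)"
  let ?J = "\<lambda>vs i. joined ladder_arcs (burnt_region a m (set (take i vs)))"
  have "(\<forall>i<length vs. ?P vs i) \<longleftrightarrow> (\<forall>i<length vs. ?Q vs i)"
    if vs: "distinct vs" "set vs = slab G a m" for vs
  proof -
    have PQ: "?P vs i \<longleftrightarrow> ?Q vs i" if "?J vs i" "i < length vs" for i
    proof (rule burnable_next_iff_hot[OF assms(1) _ that(1)])
      show "set (take i vs) \<subseteq> slab G a m" using vs set_take_subset by metis
      show "vs ! i \<in> slab G a m - set (take i vs)"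
        using vs that(2) nth_mem[OF that(2)] by (auto simp: in_set_conv_nth nth_eq_iff_index_eq)
      show "\<eta> (vs ! i) \<le> toppling_threshold G (vs ! i)" using vs that(2) stable nth_mem by metis
    qed
    have J_Suc: "?J vs (Suc i)" if J: "?J vs i" and i: "i < length vs" and P: "?P vs i" for i
    proof -
      have sub: "set (take i vs) \<subseteq> slab G a m" using vs set_take_subset by metis
      obtain u where "u \<in> burnt_region a m (set (take i vs))" "(u, vs ! i) \<in> ladder_arcs"
        using P unfolding left_boundary_def left_component_eq_burnt_region[OF assms(1) sub J]
        by blast
      moreover have "vs ! i \<in> pverts G \<times> UNIV"
        using vs nth_mem[OF i] by (auto simp: slab_def)
      ultimately show ?thesis
        using joined_burnt_region_insert[OF J] i by (simp add: take_Suc_conv_app_nth)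
    qed
    \<comment> \<open>Joinedness at \<open>i\<close> depends only on the conditions at smaller
      indices, so it is available in both directions of the equivalence.\<close>
    have J: "?J vs i" if "\<And>j. j < i \<Longrightarrow> ?J vs j \<Longrightarrow> ?P vs j" "i \<le> length vs" for i
      using that
    proof (induction i)
      case 0
      then show ?case by (simp add: joined_burnt_region_empty)
    next
      case (Suc i)
      then show ?case using J_Suc[of i] by (simp add: Suc_le_eq)
    qed
    show ?thesis
    proof safe
      fix i assume "\<forall>i<length vs. ?P vs i" "i < length vs"
      then show "?Q vs i" using PQ[of i] J[of i] by simp
    next
      fix i assume *: "\<forall>i<length vs. ?Q vs i" "i < length vs"
      have "?J vs i" by (rule J) (use * PQ in auto)
      then show "vs ! i \<in> left_boundary G (slab G a m - set (take i vs))"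
        and "int (\<eta> (vs ! i)) > int (toppling_threshold G (vs ! i)) -
        int (card {u \<in> left_component G (slab G a m - set (take i vs)). (u, vs ! i) \<in> ladder_arcs})"
        using PQ * by blast+
    qed
  qed
  then show ?thesis
    unfolding left_burnable_def burning_order_def Let_def by blast
qed

text \<open>By monotonicity the order of burning is irrelevant, so the burnt set is the least closed set
  containing everything left of rung \<open>a\<close>, when the part \<open>X\<close> of rung \<open>k + 1\<close> is kept burnt.\<close>

definition fire :: "('a \<times> int \<Rightarrow> nat) \<Rightarrow> int \<Rightarrow> int \<Rightarrow> 'a set \<Rightarrow> ('a \<times> int) set" where
  "fire \<eta> a k X = \<Inter>{D. left_half G (a - 1) \<subseteq> D \<and> D \<subseteq> left_half G k \<and>
     (\<forall>v \<in> slab G a k. hot \<eta> (D \<union> X \<times> {k + 1}) v \<longrightarrow> v \<in> D)}"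

lemma fire_least:
  assumes "left_half G (a - 1) \<subseteq> D" "D \<subseteq> left_half G k"
    and "\<And>v. v \<in> slab G a k \<Longrightarrow> hot \<eta> (D \<union> X \<times> {k + 1}) v \<Longrightarrow> v \<in> D"
  shows "fire \<eta> a k X \<subseteq> D"
  using assms unfolding fire_def by blast

lemma fire_bounds:
  assumes "a - 1 \<le> k"
  shows "left_half G (a - 1) \<subseteq> fire \<eta> a k X" "fire \<eta> a k X \<subseteq> left_half G k"
proof -
  show "left_half G (a - 1) \<subseteq> fire \<eta> a k X" unfolding fire_def by blast
  show "fire \<eta> a k X \<subseteq> left_half G k"
    using left_half_Un_slab[OF assms] by (intro fire_least) auto
qed

text \<open>As in the Knaster-Tarski theorem: a site that is hot for the intersection is hot for
  every member \<open>D\<close>, hence lies in all of them.\<close>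

lemma fire_closed:
  assumes "v \<in> slab G a k" "hot \<eta> (fire \<eta> a k X \<union> X \<times> {k + 1}) v"
  shows "v \<in> fire \<eta> a k X"
  unfolding fire_def
proof (rule InterI, clarify del: subsetI)
  fix D assume D: "left_half G (a - 1) \<subseteq> D" "D \<subseteq> left_half G k"
    "\<forall>v\<in>slab G a k. hot \<eta> (D \<union> X \<times> {k + 1}) v \<longrightarrow> v \<in> D"
  then have "fire \<eta> a k X \<subseteq> D" by (intro fire_least) auto
  then have "hot \<eta> (D \<union> X \<times> {k + 1}) v"
    by (intro hot_mono[OF assms(2)]) auto
  then show "v \<in> D" using D assms(1) by blast
qed

definition rung :: "('a \<times> int) set \<Rightarrow> int \<Rightarrow> 'a set" where
  "rung B k = {x. (x, k) \<in> B}"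

text \<open>Induction along the order. The right half touches the slab only through rung
  \<open>m + 1\<close>, which is counted as burnt from the outset here.\<close>

lemma burning_order_imp_fire_full:
  assumes "a \<le> m" "burning_order \<eta> a m vs" "set vs = slab G a m"
  shows "fire \<eta> a m (pverts G) = left_half G m"
proof -
  have "vs ! i \<in> fire \<eta> a m (pverts G)" if "i < length vs" for i
    using that
  proof (induction i rule: less_induct)
    case (less i)
    have vi: "vs ! i \<in> slab G a m" using assms(3) less.prems nth_mem by metis
    have prev: "u \<in> fire \<eta> a m (pverts G)" if "u \<in> set (take i vs)" for u
      using that less by (auto simp: in_set_conv_nth)
    have "hot \<eta> (burnt_region a m (set (take i vs))) (vs ! i)"
      using assms(2) less.prems by (simp add: burning_order_def)
    then have "hot \<eta> (fire \<eta> a m (pverts G) \<union> pverts G \<times> {m + 1}) (vs ! i)"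
    proof (rule hot_mono)
      fix u assume "(u, vs ! i) \<in> ladder_arcs" "u \<in> burnt_region a m (set (take i vs))"
      then show "u \<in> fire \<eta> a m (pverts G) \<union> pverts G \<times> {m + 1}"
        using prev vi fire_bounds(1)[of a m \<eta> "pverts G"] assms(1)
        by (cases u; cases "vs ! i")
           (auto simp: burnt_region_def ladder_arcs_iff slab_def split: if_splits)
    qed
    then show ?case using fire_closed vi by blast
  qed
  then have "slab G a m \<subseteq> fire \<eta> a m (pverts G)"
    by (metis assms(3) in_set_conv_nth subsetI)
  then show ?thesis
    using fire_bounds[of a m \<eta> "pverts G"] left_half_Un_slab[of a m] assms(1) by auto
qed

text \<open>Up to and including the first site burnt on rung \<open>m\<close>, the right half is
  still closed, so this initial part of the order is driven by the left alone.\<close>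

lemma burning_order_imp_fire_reaches:
  assumes "a \<le> m" "burning_order \<eta> a m vs" "set vs = slab G a m"
  shows "rung (fire \<eta> a m {}) m \<noteq> {}"
proof -
  let ?hit = "\<lambda>i. i < length vs \<and> snd (vs ! i) = m"
  obtain x where "x \<in> pverts G" using pverts_nonempty by blast
  then have "(x, m) \<in> set vs" using assms(1,3) by (simp add: slab_def)
  then have ex: "\<exists>i. ?hit i" by (auto simp: in_set_conv_nth)
  define i where "i = (LEAST i. ?hit i)"
  have i: "?hit i" unfolding i_def by (rule LeastI_ex[OF ex])
  have first: "\<not> ?hit j" if "j < i" for j
    using that unfolding i_def by (rule not_less_Least)
  have "vs ! j \<in> fire \<eta> a m {}" if "j \<le> i" for j
    using that
  proof (induction j rule: less_induct)
    case (less j)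
    have j: "j < length vs" using less.prems i by simp
    have vj: "vs ! j \<in> slab G a m" using assms(3) j nth_mem by metis
    have prev: "u \<in> fire \<eta> a m {} \<and> snd u \<noteq> m" if "u \<in> set (take j vs)" for u
      using that less first i by (force simp: in_set_conv_nth)
    then have "set (take j vs) \<inter> pverts G \<times> {m} = {}" by fastforce
    then have "burnt_region a m (set (take j vs)) = left_half G (a - 1) \<union> set (take j vs)"
      by (simp add: burnt_region_def)
    moreover have "hot \<eta> (burnt_region a m (set (take j vs))) (vs ! j)"
      using assms(2) j by (simp add: burning_order_def)
    ultimately have "hot \<eta> (fire \<eta> a m {} \<union> {} \<times> {m + 1}) (vs ! j)"
      using prev fire_bounds(1)[of a m \<eta> "{}"] assms(1) by (auto elim!: hot_mono)
    then show ?case using fire_closed vj by blast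
  qed
  then have "vs ! i \<in> fire \<eta> a m {}" by simp
  then have "fst (vs ! i) \<in> rung (fire \<eta> a m {}) m"
    using i by (auto simp: rung_def)
  then show ?thesis by blast
qed

text \<open>An order of maximal length admits no further hot site, so its burnt set contains the
  fire from the left. That fire reaches rung \<open>m\<close> and opens the right half; the burnt
  set then contains the fire from both sides as well, which is everything.\<close>

lemma burning_order_exists:
  assumes "a \<le> m" "rung (fire \<eta> a m {}) m \<noteq> {}" "fire \<eta> a m (pverts G) = left_half G m"
  shows "\<exists>vs. burning_order \<eta> a m vs \<and> set vs = slab G a m"
proof -
  have "burning_order \<eta> a m []" by (simp add: burning_order_def)
  moreover have "length vs < Suc (card (slab G a m))" if "burning_order \<eta> a m vs" for vs
    using that card_mono[OF finite_slab] by (auto simp: burning_order_def less_Suc_eq_le simp flip: distinct_card)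
  ultimately obtain vs where vs: "burning_order \<eta> a m vs"
    and maximal: "\<And>ws. burning_order \<eta> a m ws \<Longrightarrow> length ws \<le> length vs"
    by (metis ex_has_greatest_nat)
  have stuck: "v \<in> set vs" if "v \<in> slab G a m" "hot \<eta> (burnt_region a m (set vs)) v" for v
  proof (rule ccontr)
    assume "v \<notin> set vs"
    then have "burning_order \<eta> a m (vs @ [v])"
      using vs that by (auto simp: burning_order_def nth_append less_Suc_eq)
    then have "length (vs @ [v]) \<le> length vs" by (rule maximal)
    then show False by simp
  qed
  let ?D = "left_half G (a - 1) \<union> set vs"
  have D: "left_half G (a - 1) \<subseteq> ?D" "?D \<subseteq> left_half G m"
    using vs left_half_Un_slab[of a m] assms(1) by (auto simp: burning_order_def)
  have "fire \<eta> a m {} \<subseteq> ?D"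
    using D by (rule fire_least) (auto intro!: stuck elim: hot_mono simp: burnt_region_def)
  moreover have "(x, m) \<notin> left_half G (a - 1)" for x
    using assms(1) by (simp add: left_half_def)
  ultimately obtain x where "(x, m) \<in> set vs"
    using assms(2) by (auto simp: rung_def)
  then have "set vs \<inter> pverts G \<times> {m} \<noteq> {}"
    using vs by (auto simp: burning_order_def slab_def)
  then have "burnt_region a m (set vs) = ?D \<union> right_half (m + 1)"
    by (simp add: burnt_region_def)
  then have "fire \<eta> a m (pverts G) \<subseteq> ?D"
    using D by (intro fire_least) (auto intro!: stuck elim: hot_mono)
  then have "slab G a m \<subseteq> ?D"
    using assms left_half_Un_slab[of a m] by auto
  then have "set vs = slab G a m"
    using vs by (auto simp: burning_order_def slab_def left_half_def)
  then show ?thesis using vs by blast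
qed

lemma left_burnable_iff_fire:
  assumes "a \<le> m" "\<And>v. v \<in> slab G a m \<Longrightarrow> \<eta> v \<le> toppling_threshold G v"
  shows "left_burnable G (slab G a m) \<eta> \<longleftrightarrow>
     rung (fire \<eta> a m {}) m \<noteq> {} \<and> fire \<eta> a m (pverts G) = left_half G m"
  using left_burnable_iff_burning_order[OF assms] burning_order_exists[OF assms(1)]
    burning_order_imp_fire_full[OF assms(1)] burning_order_imp_fire_reaches[OF assms(1)]
  by meson

section \<open>The transfer map between rungs\<close>

text \<open>The burning condition seen from one rung: \<open>P\<close>, \<open>Y\<close> and
  \<open>X\<close> are the burnt parts of the rung before, of the rung itself and of the rung after
  it.\<close>

definition heated :: "('a \<Rightarrow> nat) \<Rightarrow> 'a \<Rightarrow> 'a set \<Rightarrow> 'a set \<Rightarrow> 'a set \<Rightarrow> bool" where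
  "heated c x P Y X \<longleftrightarrow> out_degree (with_proj G) x + 2 <
     c x + card {y \<in> Y. (y, x) \<in> parcs G} + of_bool (x \<in> P) + of_bool (x \<in> X)"

lemma hot_iff_heated:
  assumes "B \<subseteq> pverts G \<times> UNIV" "x \<in> pverts G"
  shows "hot \<eta> B (x, k) \<longleftrightarrow> heated (\<lambda>x. \<eta> (x, k)) x (rung B (k - 1)) (rung B k) (rung B (k + 1))"
proof -
  let ?N = "{y \<in> rung B k. (y, x) \<in> parcs G}"
  let ?l = "if x \<in> rung B (k - 1) then {(x, k - 1)} else {}"
  let ?r = "if x \<in> rung B (k + 1) then {(x, k + 1)} else {}"
  have "{u \<in> B. (u, (x, k)) \<in> ladder_arcs} = (\<lambda>y. (y, k)) ` ?N \<union> (?l \<union> ?r)"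
  proof -
    have "\<bar>l - k\<bar> = 1 \<longleftrightarrow> l = k - 1 \<or> l = k + 1" for l by arith
    then show ?thesis
      using assms by (auto simp: ladder_arcs_iff rung_def dest: wellformed')
  qed
  moreover have "finite ?N"
    by (rule finite_subset[OF _ pair_finite_verts]) (auto dest: wellformed')
  moreover have "card ((\<lambda>y. (y, k)) ` ?N) = card ?N"
    by (rule card_image) (simp add: inj_on_def)
  moreover have "card (?l \<union> ?r) = of_bool (x \<in> rung B (k - 1)) + of_bool (x \<in> rung B (k + 1))"
    by auto
  moreover have "(\<lambda>y. (y, k)) ` ?N \<inter> (?l \<union> ?r) = {}" by auto
  ultimately have "card {u \<in> B. (u, (x, k)) \<in> ladder_arcs} =
      card ?N + (of_bool (x \<in> rung B (k - 1)) + of_bool (x \<in> rung B (k + 1)))"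
    by (simp add: card_Un_disjoint)
  then show ?thesis
    by (simp add: hot_def heated_def toppling_threshold_def)
qed

lemma heated_mono:
  assumes "heated c x P Y X" "P \<subseteq> P'" "Y \<subseteq> Y'" "X \<subseteq> X'"
  shows "heated c x P' Y' X'"
proof -
  have "card {y \<in> Y. (y, x) \<in> parcs G} \<le> card {y \<in> Y'. (y, x) \<in> parcs G}"
    using assms(3) by (intro card_mono finite_subset[OF _ pair_finite_verts]) (auto dest: wellformed')
  moreover have "of_bool (x \<in> P) \<le> (of_bool (x \<in> P') :: nat)" "of_bool (x \<in> X) \<le> (of_bool (x \<in> X') :: nat)"
    using assms by auto
  ultimately show ?thesis
    using assms(1) unfolding heated_def by linarith
qed

text \<open>\<open>Y\<close> is a candidate for the burnt part of the current rung, and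
  \<open>f\<close> returns what burns on the rung before in response to it. \<open>X\<close> is held
  burnt on the rung after.\<close>

definition absorbing :: "('a \<Rightarrow> nat) \<Rightarrow> ('a set \<Rightarrow> 'a set) \<Rightarrow> 'a set \<Rightarrow> 'a set \<Rightarrow> bool" where
  "absorbing c f X Y \<longleftrightarrow> Y \<subseteq> pverts G \<and> (\<forall>x\<in>pverts G. heated c x (f Y) Y X \<longrightarrow> x \<in> Y)"

text \<open>For monotone \<open>f\<close> this is the least absorbing set. Restriction to
  \<open>Pow (pverts G)\<close> makes the map extensional, as \<open>states\<close> demands.\<close>

definition transfer :: "('a \<Rightarrow> nat) \<Rightarrow> ('a set \<Rightarrow> 'a set) \<Rightarrow> 'a set \<Rightarrow> 'a set" where
  "transfer c f = (\<lambda>X\<in>Pow (pverts G). \<Inter>{Y. absorbing c f X Y})"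

lemma absorbing_pverts: "absorbing c f X (pverts G)"
  by (simp add: absorbing_def)

lemma transfer_subset: "X \<subseteq> pverts G \<Longrightarrow> transfer c f X \<subseteq> pverts G"
  using absorbing_pverts by (auto simp: transfer_def)

lemma transfer_le: "absorbing c f X Y \<Longrightarrow> X \<subseteq> pverts G \<Longrightarrow> transfer c f X \<subseteq> Y"
  by (auto simp: transfer_def)

lemma transfer_cong:
  assumes "\<And>x. x \<in> pverts G \<Longrightarrow> c x = d x"
  shows "transfer c f = transfer d f"
  using assms by (simp add: transfer_def absorbing_def heated_def)

text \<open>More heat means fewer absorbing sets, hence a larger intersection.\<close>

lemma transfer_mono:
  assumes "X \<subseteq> X'" "X' \<subseteq> pverts G" "\<And>Y. Y \<subseteq> pverts G \<Longrightarrow> f Y \<subseteq> g Y"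
  shows "transfer c f X \<subseteq> transfer c g X'"
proof -
  have "absorbing c f X Y" if Y: "absorbing c g X' Y" for Y
    unfolding absorbing_def
  proof (intro conjI ballI impI)
    show YV: "Y \<subseteq> pverts G" using Y by (simp add: absorbing_def)
    fix x assume x: "x \<in> pverts G" "heated c x (f Y) Y X"
    have "heated c x (g Y) Y X'"
      by (rule heated_mono[OF x(2) assms(3)[OF YV] order_refl assms(1)])
    then show "x \<in> Y" using Y x(1) by (simp add: absorbing_def)
  qed
  then show ?thesis
    using assms by (auto simp: transfer_def)
qed

text \<open>\<open>front \<eta> a k X\<close> is the burnt part of rung \<open>k\<close> once all rungs left of \<open>a\<close>, and the part
  \<open>X\<close> of rung \<open>k + 1\<close>, are burnt. At \<open>k = a - 1\<close> it is everything.\<close>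

definition front :: "('a \<times> int \<Rightarrow> nat) \<Rightarrow> int \<Rightarrow> int \<Rightarrow> 'a set \<Rightarrow> 'a set" where
  "front \<eta> a k = (\<lambda>X\<in>Pow (pverts G). rung (fire \<eta> a k X) k)"

abbreviation full_front :: "'a set \<Rightarrow> 'a set" where
  "full_front \<equiv> (\<lambda>X\<in>Pow (pverts G). pverts G)"

lemma fire_initial: "fire \<eta> a (a - 1) X = left_half G (a - 1)"
  using fire_bounds[of a "a - 1"] by fastforce

lemma front_initial: "front \<eta> a (a - 1) = full_front"
  unfolding front_def fire_initial by (auto simp: rung_def left_half_def)

text \<open>Let \<open>?Z\<close> be the burnt part of rung \<open>k + 1\<close>. The fire up to
  rung \<open>k\<close> driven by \<open>?Z\<close> stays inside the larger fire, so
  \<open>?Z\<close> is absorbing. Conversely, for absorbing \<open>Y\<close>, the fire up to rung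
  \<open>k\<close> driven by \<open>Y\<close>, together with \<open>Y\<close> on rung
  \<open>k + 1\<close>, is closed and so contains the larger fire.\<close>

lemma front_step:
  assumes k: "a - 1 \<le> k"
  shows "front \<eta> a (k + 1) = transfer (\<lambda>x. \<eta> (x, k + 1)) (front \<eta> a k)"
proof (rule ext)
  fix X
  let ?c = "\<lambda>x. \<eta> (x, k + 1)"
  let ?B = "fire \<eta> a (k + 1) X"
  let ?Z = "rung ?B (k + 1)"
  have "?Z = \<Inter>{Y. absorbing ?c (front \<eta> a k) X Y}" if X: "X \<subseteq> pverts G"
  proof
    have B: "left_half G (a - 1) \<subseteq> ?B" "?B \<subseteq> left_half G (k + 1)"
      using fire_bounds[of a "k + 1"] k by simp_all
    have Z: "?Z \<subseteq> pverts G" using B by (auto simp: rung_def left_half_def)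
    have "fire \<eta> a k ?Z \<subseteq> ?B \<inter> left_half G k"
    proof (rule fire_least)
      show "left_half G (a - 1) \<subseteq> ?B \<inter> left_half G k"
        using B left_half_Un_slab[OF k] by blast
      fix v assume v: "v \<in> slab G a k" "hot \<eta> (?B \<inter> left_half G k \<union> ?Z \<times> {k + 1}) v"
      then have "hot \<eta> (?B \<union> X \<times> {k + 1 + 1}) v"
        by (intro hot_mono[OF v(2)]) (auto simp: rung_def)
      then have "v \<in> ?B"
        using v(1) by (intro fire_closed) (auto simp: slab_def)
      then show "v \<in> ?B \<inter> left_half G k"
        using v(1) by (auto simp: slab_def left_half_def)
    qed blast
    then have front_Z: "front \<eta> a k ?Z \<subseteq> rung ?B k"
      using Z by (auto simp: front_def rung_def)
    have "absorbing ?c (front \<eta> a k) X ?Z"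
      unfolding absorbing_def
    proof (intro conjI ballI impI Z)
      fix x assume x: "x \<in> pverts G" "heated ?c x (front \<eta> a k ?Z) ?Z X"
      let ?C = "?B \<union> X \<times> {k + 1 + 1}"
      have C: "?C \<subseteq> pverts G \<times> UNIV"
        using B X by (auto simp: left_half_def)
      have "heated ?c x (rung ?C (k + 1 - 1)) (rung ?C (k + 1)) (rung ?C (k + 1 + 1))"
        by (rule heated_mono[OF x(2)]) (use front_Z in \<open>auto simp: rung_def\<close>)
      then have "hot \<eta> ?C (x, k + 1)"
        using hot_iff_heated[OF C x(1)] by simp
      then have "(x, k + 1) \<in> ?B"
        using x(1) k by (intro fire_closed) (auto simp: slab_def)
      then show "x \<in> ?Z" by (simp add: rung_def)
    qed
    then show "\<Inter>{Y. absorbing ?c (front \<eta> a k) X Y} \<subseteq> ?Z" by blast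
    show "?Z \<subseteq> \<Inter>{Y. absorbing ?c (front \<eta> a k) X Y}"
    proof (rule Inter_greatest, clarify del: subsetI)
      fix Y assume Y: "absorbing ?c (front \<eta> a k) X Y"
      then have YV: "Y \<subseteq> pverts G" by (simp add: absorbing_def)
      let ?F = "fire \<eta> a k Y"
      let ?D = "?F \<union> Y \<times> {k + 1}"
      have F: "left_half G (a - 1) \<subseteq> ?F" "?F \<subseteq> left_half G k"
        using fire_bounds[OF k] by simp_all
      have "?B \<subseteq> ?D"
      proof (rule fire_least)
        show "left_half G (a - 1) \<subseteq> ?D" using F by blast
        show "?D \<subseteq> left_half G (k + 1)" using F YV by (auto simp: left_half_def)
        fix v assume v: "v \<in> slab G a (k + 1)" "hot \<eta> (?D \<union> X \<times> {k + 1 + 1}) v"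
        obtain x l where [simp]: "v = (x, l)" by force
        show "v \<in> ?D"
        proof (cases "l = k + 1")
          case True
          let ?C = "?D \<union> X \<times> {k + 1 + 1}"
          have x: "x \<in> pverts G" using v(1) by (simp add: slab_def)
          have C: "?C \<subseteq> pverts G \<times> UNIV" using F X YV by (auto simp: left_half_def)
          have "rung ?C (k + 1 - 1) = front \<eta> a k Y" "rung ?C (k + 1) = Y" "rung ?C (k + 1 + 1) = X"
            using F YV by (auto simp: rung_def front_def left_half_def)
          then have "heated ?c x (front \<eta> a k Y) Y X"
            using v(2) hot_iff_heated[OF C x, of \<eta> "k + 1"] True by simp
          then show ?thesis using Y x True by (simp add: absorbing_def)
        next
          case False
          then have vk: "v \<in> slab G a k" using v(1) by (auto simp: slab_def)
          have "hot \<eta> ?D v"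
            by (rule hot_mono[OF v(2)]) (use vk in \<open>auto simp: ladder_arcs_iff slab_def\<close>)
          then show ?thesis using fire_closed[OF vk] by blast
        qed
      qed
      then show "?Z \<subseteq> Y" using F by (auto simp: rung_def left_half_def)
    qed
  qed
  then show "front \<eta> a (k + 1) X = transfer ?c (front \<eta> a k) X"
    by (simp add: front_def transfer_def)
qed

section \<open>Liveness of the fronts and left-burnability\<close>

definition live :: "('a set \<Rightarrow> 'a set) \<Rightarrow> bool" where
  "live f \<longleftrightarrow> f {} \<noteq> {} \<and> f (pverts G) = pverts G"

text \<open>Once rung \<open>k + 1\<close> has burnt completely, it screens the earlier rungs from
  rung \<open>k + 2\<close> and supplies exactly the boundary condition for the fire up to rung
  \<open>k\<close>.\<close>

lemma fire_full_step:
  assumes k: "a - 1 \<le> k"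
  shows "fire \<eta> a (k + 1) (pverts G) = left_half G (k + 1) \<longleftrightarrow>
     front \<eta> a (k + 1) (pverts G) = pverts G \<and> fire \<eta> a k (pverts G) = left_half G k"
proof -
  let ?B = "fire \<eta> a (k + 1) (pverts G)" and ?F = "fire \<eta> a k (pverts G)"
  have B: "left_half G (a - 1) \<subseteq> ?B" "?B \<subseteq> left_half G (k + 1)"
    using fire_bounds[of a "k + 1"] k by simp_all
  have F: "left_half G (a - 1) \<subseteq> ?F" "?F \<subseteq> left_half G k"
    using fire_bounds[OF k] by simp_all
  show ?thesis
  proof (intro iffI conjI)
    assume full: "?B = left_half G (k + 1)"
    then show "front \<eta> a (k + 1) (pverts G) = pverts G"
      by (auto simp: front_def rung_def left_half_def)
    have "?B \<subseteq> ?F \<union> pverts G \<times> {k + 1}"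
    proof (rule fire_least)
      fix v assume v: "v \<in> slab G a (k + 1)"
        "hot \<eta> (?F \<union> pverts G \<times> {k + 1} \<union> pverts G \<times> {k + 1 + 1}) v"
      show "v \<in> ?F \<union> pverts G \<times> {k + 1}"
      proof (cases "snd v = k + 1")
        case True
        then show ?thesis using v(1) by (cases v) (auto simp: slab_def)
      next
        case False
        then have vk: "v \<in> slab G a k" using v(1) by (auto simp: slab_def)
        have "hot \<eta> (?F \<union> pverts G \<times> {k + 1}) v"
          by (rule hot_mono[OF v(2)]) (use vk in \<open>auto simp: ladder_arcs_iff slab_def\<close>)
        then show ?thesis using fire_closed[OF vk] by blast
      qed
    qed (use F in \<open>auto simp: left_half_def\<close>)
    moreover have "left_half G k \<subseteq> left_half G (k + 1)" "left_half G k \<inter> pverts G \<times> {k + 1} = {}"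
      by (auto simp: left_half_def)
    ultimately show "?F = left_half G k"
      unfolding full using F(2) by blast
  next
    assume *: "front \<eta> a (k + 1) (pverts G) = pverts G \<and> ?F = left_half G k"
    then have top: "pverts G \<times> {k + 1} \<subseteq> ?B"
      by (auto simp: front_def rung_def)
    have "?F \<subseteq> ?B \<inter> left_half G k"
    proof (rule fire_least)
      show "left_half G (a - 1) \<subseteq> ?B \<inter> left_half G k"
        using B left_half_Un_slab[OF k] by blast
      fix v assume v: "v \<in> slab G a k" "hot \<eta> (?B \<inter> left_half G k \<union> pverts G \<times> {k + 1}) v"
      have "hot \<eta> (?B \<union> pverts G \<times> {k + 1 + 1}) v"
        by (rule hot_mono[OF v(2)]) (use top in auto)
      then have "v \<in> ?B"
        using v(1) by (intro fire_closed) (auto simp: slab_def)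
      then show "v \<in> ?B \<inter> left_half G k"
        using v(1) by (auto simp: slab_def left_half_def)
    qed blast
    moreover have "left_half G (k + 1) = left_half G k \<union> pverts G \<times> {k + 1}"
      by (auto simp: left_half_def)
    ultimately show "?B = left_half G (k + 1)"
      using conjunct2[OF *] top B(2) by blast
  qed
qed

lemma fire_full_iff:
  assumes "a - 1 \<le> m"
  shows "fire \<eta> a m (pverts G) = left_half G m \<longleftrightarrow>
    (\<forall>k\<in>{a..m}. front \<eta> a k (pverts G) = pverts G)"
  using assms
proof (induction m rule: int_ge_induct)
  case base
  show ?case by (simp add: fire_initial)
next
  case (step m)
  have "{a..m + 1} = insert (m + 1) {a..m}" using step.hyps by auto
  then show ?case using step fire_full_step by simp
qed

text \<open>With stable values nothing is heated without a burnt neighbour, so the empty set is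
  absorbing.\<close>

lemma transfer_extinct:
  assumes "\<And>x. x \<in> pverts G \<Longrightarrow> c x \<le> out_degree (with_proj G) x + 2" "f {} = {}"
  shows "transfer c f {} = {}"
proof -
  have "absorbing c f {} {}"
    using assms by (fastforce simp: absorbing_def heated_def)
  then show ?thesis using transfer_le by blast
qed

text \<open>The two halves of \<open>live\<close> say that the fire from the left gets as far as rung \<open>k\<close> unaided, and
  that it burns everything once the next rung is burnt.\<close>

lemma left_burnable_iff_live:
  assumes "a \<le> m" and stable: "\<And>v. v \<in> slab G a m \<Longrightarrow> \<eta> v \<le> toppling_threshold G v"
  shows "left_burnable G (slab G a m) \<eta> \<longleftrightarrow> (\<forall>k\<in>{a..m}. live (front \<eta> a k))"
proof -
  \<comment> \<open>Extinction passes from each rung to the next, so a fire that reaches rung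
    \<open>m\<close> has reached every earlier rung.\<close>
  have reach: "front \<eta> a k {} \<noteq> {}" if "a \<le> k" "k \<le> m" "front \<eta> a m {} \<noteq> {}" for k
    using that(2,1,3)
  proof (induction k rule: int_le_induct)
    case (step i)
    have "front \<eta> a i = transfer (\<lambda>x. \<eta> (x, i)) (front \<eta> a (i - 1))"
      using front_step[of a "i - 1" \<eta>] step.prems by simp
    moreover have "\<eta> (x, i) \<le> out_degree (with_proj G) x + 2" if "x \<in> pverts G" for x
      using stable[of "(x, i)"] that step by (simp add: slab_def toppling_threshold_def)
    ultimately show ?case
      using transfer_extinct[of "\<lambda>x. \<eta> (x, i)" "front \<eta> a (i - 1)"] step by fastforce
  qed
  have "rung (fire \<eta> a m {}) m = front \<eta> a m {}"
    by (simp add: front_def)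
  moreover have "fire \<eta> a m (pverts G) = left_half G m \<longleftrightarrow>
      (\<forall>k\<in>{a..m}. front \<eta> a k (pverts G) = pverts G)"
    using assms(1) by (intro fire_full_iff) simp
  moreover have "(\<forall>k\<in>{a..m}. front \<eta> a k {} \<noteq> {}) \<longleftrightarrow> front \<eta> a m {} \<noteq> {}"
    using reach assms(1) by (meson atLeastAtMost_iff order_refl)
  moreover have "left_burnable G (slab G a m) \<eta> \<longleftrightarrow>
      rung (fire \<eta> a m {}) m \<noteq> {} \<and> fire \<eta> a m (pverts G) = left_half G m"
    by (rule left_burnable_iff_fire[OF assms(1) stable])
  ultimately show ?thesis
    by (simp only: live_def ball_conj_distrib)
qed

section \<open>The automaton\<close>

text \<open>This is the liveness criterion for \<open>a = m = 0\<close>, where the front at rung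
  \<open>-1\<close> is \<open>full_front\<close>.\<close>

lemma rung_configs_iff:
  "c \<in> rung_configs G \<longleftrightarrow>
     c \<in> (\<Pi>\<^sub>E x\<in>pverts G. {1..out_degree (with_proj G) x + 2}) \<and> live (transfer c full_front)"
proof -
  have front0: "front \<eta> 0 0 = transfer (\<lambda>x. \<eta> (x, 0)) full_front" for \<eta>
    using front_step[of 0 "-1" \<eta>] front_initial[of \<eta> 0] by simp
  have Omega: "\<eta> \<in> Omega_L G 0 0 \<longleftrightarrow>
      \<eta> \<in> stable_configs G (slab G 0 0) \<and> live (transfer (\<lambda>x. \<eta> (x, 0)) full_front)" for \<eta>
    using left_burnable_iff_live[of 0 0 \<eta>]
    by (auto simp: Omega_L_def stable_configs_def PiE_iff front0)
  show ?thesis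
  proof
    assume "c \<in> rung_configs G"
    then obtain \<eta> where \<eta>: "\<eta> \<in> Omega_L G 0 0" and c: "c = (\<lambda>x\<in>pverts G. \<eta> (x, 0))"
      by (auto simp: rung_configs_def)
    have "transfer c full_front = transfer (\<lambda>x. \<eta> (x, 0)) full_front"
      by (rule transfer_cong) (simp add: c)
    then show "c \<in> (\<Pi>\<^sub>E x\<in>pverts G. {1..out_degree (with_proj G) x + 2}) \<and> live (transfer c full_front)"
      using \<eta> unfolding Omega by (auto simp: c stable_configs_def PiE_iff slab_def toppling_threshold_def)
  next
    assume c: "c \<in> (\<Pi>\<^sub>E x\<in>pverts G. {1..out_degree (with_proj G) x + 2}) \<and> live (transfer c full_front)"
    let ?\<eta> = "\<lambda>u\<in>slab G 0 0. c (fst u)"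
    have "transfer (\<lambda>x. ?\<eta> (x, 0)) full_front = transfer c full_front"
      by (rule transfer_cong) (simp add: slab_def)
    then have "?\<eta> \<in> Omega_L G 0 0"
      using c unfolding Omega by (auto simp: stable_configs_def PiE_iff slab_def toppling_threshold_def)
    moreover have "c = (\<lambda>x\<in>pverts G. ?\<eta> (x, 0))"
      using c by (intro ext) (auto simp: slab_def PiE_iff extensional_def)
    ultimately show "c \<in> rung_configs G"
      unfolding rung_configs_def by blast
  qed
qed

text \<open>\<open>full_front\<close> dominates every \<open>f\<close>, so by monotonicity liveness
  after any \<open>f\<close> implies liveness after \<open>full_front\<close>. In this way the rungs
  of a left-burnable configuration are seen to lie in \<open>rung_configs G\<close>.\<close>

lemma rung_configsI:
  assumes "c \<in> (\<Pi>\<^sub>E x\<in>pverts G. {1..out_degree (with_proj G) x + 2})"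
    and "live (transfer c f)" "\<And>Y. Y \<subseteq> pverts G \<Longrightarrow> f Y \<subseteq> pverts G"
  shows "c \<in> rung_configs G"
proof -
  have "transfer c f X \<subseteq> transfer c full_front X" if "X \<subseteq> pverts G" for X
    by (rule transfer_mono) (use that assms in auto)
  then have "live (transfer c full_front)"
    using assms(2) transfer_subset[of "pverts G" c full_front] unfolding live_def by blast
  then show ?thesis using assms(1) by (simp add: rung_configs_iff)
qed

definition start_state :: "('a \<Rightarrow> nat) \<Rightarrow> 'a state" where
  "start_state c = (c, pverts G, transfer c full_front)"

text \<open>Liveness of the target is not tested here but built into
  \<open>front_states\<close>.\<close>

definition front_matrix :: "'a state \<Rightarrow> 'a state \<Rightarrow> nat" where
  "front_matrix a b = of_bool (snd (snd b) = transfer (fst b) (snd (snd a)))"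

inductive_set front_states :: "'a state set" where
  start: "c \<in> rung_configs G \<Longrightarrow> start_state c \<in> front_states"
| step: "a \<in> front_states \<Longrightarrow> c \<in> rung_configs G \<Longrightarrow> live (transfer c (snd (snd a))) \<Longrightarrow>
    (c, pverts G, transfer c (snd (snd a))) \<in> front_states"

lemma front_statesE:
  assumes "a \<in> front_states"
  obtains c f where "a = (c, pverts G, transfer c f)" "c \<in> rung_configs G" "live (transfer c f)"
  using assms by cases (auto simp: start_state_def rung_configs_iff)

lemma front_states_subset: "front_states \<subseteq> states G"
proof
  fix a assume "a \<in> front_states"
  then obtain c f where "a = (c, pverts G, transfer c f)" "c \<in> rung_configs G"
    by (rule front_statesE)
  then show "a \<in> states G"
    using transfer_subset by (fastforce simp: states_def transfer_def)
qed

lemma finite_front_states: "finite front_states"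
proof -
  have "rung_configs G \<subseteq> (\<Pi>\<^sub>E x\<in>pverts G. {1..out_degree (with_proj G) x + 2})"
    using rung_configs_iff by blast
  then have "finite (rung_configs G)"
    using pair_finite_verts by (meson finite_PiE finite_atLeastAtMost finite_subset)
  then have "finite (states G)"
    unfolding states_def using pair_finite_verts by (intro finite_cartesian_product finite_PiE) auto
  then show ?thesis using front_states_subset by (rule rev_finite_subset)
qed

section \<open>Reset by the maximal configuration\<close>

definition max_config :: "'a \<Rightarrow> nat" where
  "max_config = (\<lambda>x\<in>pverts G. out_degree (with_proj G) x + 2)"

text \<open>The maximal configuration acts as a reset: a fire that reaches its rung spreads along all of
  \<open>G\<close>, which erases the memory of the earlier rungs.\<close>

lemma transfer_max_config:
  assumes "f {} \<noteq> {}" "\<And>Y. Y \<subseteq> pverts G \<Longrightarrow> f {} \<subseteq> f Y" "f {} \<subseteq> pverts G"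
  shows "transfer max_config f = full_front"
proof (rule ext)
  fix X
  have "Y = pverts G" if Y: "absorbing max_config f X Y" for Y
  proof -
    have YV: "Y \<subseteq> pverts G" using Y by (simp add: absorbing_def)
    \<comment> \<open>At the maximal value a single burnt neighbour is enough.\<close>
    have spread: "x \<in> Y" if "x \<in> pverts G" "x \<in> f Y \<or> (\<exists>y\<in>Y. (y, x) \<in> parcs G)" for x
    proof -
      have "finite {y \<in> Y. (y, x) \<in> parcs G}"
        using YV pair_finite_verts by (simp add: finite_subset)
      then have "heated max_config x (f Y) Y X"
        using that by (auto simp: heated_def max_config_def card_gt_0_iff)
      then show ?thesis using Y that(1) by (simp add: absorbing_def)
    qed
    \<comment> \<open>A site of \<open>f {}\<close> ignites the rung whatever \<open>Y\<close> is;
      connectedness of \<open>G\<close> does the rest.\<close>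
    obtain x where x: "x \<in> f {}" using assms(1) by blast
    then have "x \<in> pverts G" "x \<in> Y" using assms(2)[OF YV] assms(3) spread by blast+
    have "z \<in> Y" if "z \<in> pverts G" for z
      using base_reachable[OF \<open>x \<in> pverts G\<close> that] \<open>x \<in> Y\<close>
      by induction (auto intro: spread dest: wellformed')
    then show ?thesis using YV by blast
  qed
  then have "{Y. absorbing max_config f X Y} = {pverts G}"
    using absorbing_pverts by blast
  then show "transfer max_config f X = full_front X"
    by (simp add: transfer_def)
qed

lemma live_full_front: "live full_front"
  using pverts_nonempty by (simp add: live_def)

lemma transfer_max_config_full: "transfer max_config full_front = full_front"
  using pverts_nonempty by (intro transfer_max_config) auto

lemma max_config_in_rung_configs: "max_config \<in> rung_configs G"
  unfolding rung_configs_iff transfer_max_config_full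
  by (simp add: live_full_front) (simp add: max_config_def)

text \<open>Liveness makes the value of the front at \<open>{}\<close> nonempty and monotonicity
  carries it to all arguments, so the maximal rung turns the front into \<open>full_front\<close>,
  the front of the reset state.\<close>

lemma front_matrix_to_reset:
  assumes "a \<in> front_states"
  shows "front_matrix a (start_state max_config) = 1"
proof -
  obtain c f where a: "a = (c, pverts G, transfer c f)" "live (transfer c f)"
    using assms by (rule front_statesE)
  have "transfer max_config (transfer c f) = full_front"
    using a(2) by (intro transfer_max_config transfer_mono transfer_subset) (auto simp: live_def)
  then show ?thesis
    by (simp add: front_matrix_def start_state_def a(1) transfer_max_config_full)
qed

text \<open>The reset state carries \<open>full_front\<close>, as if nothing but burnt rungs
  preceded, so all start states are its successors; the other states follow along their
  derivations.\<close>

lemma reset_reaches: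
  assumes "b \<in> front_states"
  shows "\<exists>n. matrix_power front_states front_matrix n (start_state max_config) b > 0"
  using assms
proof induction
  case (start c)
  have "start_state max_config \<in> front_states"
    by (intro front_states.start max_config_in_rung_configs)
  moreover have "front_matrix (start_state max_config) (start_state c) > 0"
    by (simp add: front_matrix_def start_state_def transfer_max_config_full)
  ultimately have "matrix_power front_states front_matrix (Suc 0) (start_state max_config) (start_state c) > 0"
    by (intro matrix_power_Suc_pos[OF finite_front_states]) auto
  then show ?case by blast
next
  case (step a c)
  then obtain n where "matrix_power front_states front_matrix n (start_state max_config) a > 0"
    by blast
  then have "matrix_power front_states front_matrix (Suc n) (start_state max_config)
      (c, pverts G, transfer c (snd (snd a))) > 0"
    using step.hyps by (intro matrix_power_Suc_pos[OF finite_front_states]) (auto simp: front_matrix_def)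
  then show ?case by blast
qed

lemma transitive_front_matrix: "transitive_matrix front_states front_matrix"
  by (rule transitive_matrixI[OF finite_front_states, of "start_state max_config"])
     (auto simp: front_matrix_to_reset reset_reaches
        intro!: front_states.start max_config_in_rung_configs)

section \<open>Admissible sequences and configurations\<close>

abbreviation seqs :: "int \<Rightarrow> (int \<Rightarrow> 'a state) set" where
  "seqs \<equiv> admissible_seqs front_states (start_state ` rung_configs G) front_matrix"

abbreviation config_of :: "int \<Rightarrow> (int \<Rightarrow> 'a state) \<Rightarrow> 'a \<times> int \<Rightarrow> nat" where
  "config_of m \<omega> \<equiv> config_of_rungs G m (\<lambda>k. fst (\<omega> k))"

lemma config_of_apply: "x \<in> pverts G \<Longrightarrow> k \<in> {1..m} \<Longrightarrow> config_of m \<omega> (x, k) = fst (\<omega> k) x"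
  by (simp add: config_of_rungs_def slab_def)

lemma seqs_mem: "\<omega> \<in> seqs m \<Longrightarrow> k \<in> {1..m} \<Longrightarrow> \<omega> k \<in> front_states"
  by (auto simp: admissible_seqs_def)

text \<open>Both sides arise from \<open>full_front\<close> by the same transfers, so the first
  coordinates determine the states.\<close>

lemma seq_front:
  assumes \<omega>: "\<omega> \<in> seqs m" and k: "1 \<le> k" "k \<le> m"
  shows "snd (snd (\<omega> k)) = front (config_of m \<omega>) 1 k"
  using k
proof (induction k rule: int_ge_induct)
  case base
  have "front (config_of m \<omega>) 1 1 = transfer (\<lambda>x. config_of m \<omega> (x, 1)) full_front"
    using front_step[of 1 0 "config_of m \<omega>"] front_initial[of "config_of m \<omega>" 1] by simp
  also have "\<dots> = transfer (fst (\<omega> 1)) full_front"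
    using base by (intro transfer_cong) (simp add: config_of_apply)
  also have "\<dots> = snd (snd (\<omega> 1))"
    using \<omega> by (auto simp: admissible_seqs_def start_state_def)
  finally show ?case by simp
next
  case (step k)
  have "front (config_of m \<omega>) 1 (k + 1) =
      transfer (\<lambda>x. config_of m \<omega> (x, k + 1)) (front (config_of m \<omega>) 1 k)"
    using step.hyps by (intro front_step) simp
  also have "\<dots> = transfer (fst (\<omega> (k + 1))) (front (config_of m \<omega>) 1 k)"
    using step by (intro transfer_cong) (simp add: config_of_apply)
  also have "\<dots> = transfer (fst (\<omega> (k + 1))) (snd (snd (\<omega> k)))"
    using step by simp
  also have "\<dots> = snd (snd (\<omega> (k + 1)))"
  proof -
    have "front_matrix (\<omega> k) (\<omega> (k + 1)) = 1"
      using \<omega> step by (simp add: admissible_seqs_def)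
    then show ?thesis by (simp add: front_matrix_def of_bool_def split: if_splits)
  qed
  finally show ?case by simp
qed

lemma Omega_L_iff_live:
  assumes "m \<ge> 1"
  shows "\<eta> \<in> Omega_L G 1 m \<longleftrightarrow>
     \<eta> \<in> stable_configs G (slab G 1 m) \<and> (\<forall>k\<in>{1..m}. live (front \<eta> 1 k))"
  using left_burnable_iff_live[of 1 m \<eta>] assms
  by (auto simp: Omega_L_def stable_configs_def PiE_iff)

text \<open>Injectivity comes from \<open>seq_front\<close>; images are left-burnable because all
  states are live; a preimage is found by attaching to each rung its front.\<close>

lemma bij_betw_config_of:
  assumes m: "m \<ge> 1"
  shows "bij_betw (config_of m) (seqs m) (Omega_L G 1 m)"
proof (rule bij_betwI')
  fix \<omega> \<omega>' assume \<omega>: "\<omega> \<in> seqs m" and \<omega>': "\<omega>' \<in> seqs m"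
  show "config_of m \<omega> = config_of m \<omega>' \<longleftrightarrow> \<omega> = \<omega>'"
  proof
    assume eq: "config_of m \<omega> = config_of m \<omega>'"
    have "\<omega> k = \<omega>' k" if k: "k \<in> {1..m}" for k
    proof -
      obtain c f where a: "\<omega> k = (c, pverts G, transfer c f)" "c \<in> rung_configs G"
        using seqs_mem[OF \<omega> k] by (rule front_statesE)
      obtain d g where b: "\<omega>' k = (d, pverts G, transfer d g)" "d \<in> rung_configs G"
        using seqs_mem[OF \<omega>' k] by (rule front_statesE)
      have "c x = d x" if "x \<in> pverts G" for x
        using config_of_apply[OF that k, of \<omega>] config_of_apply[OF that k, of \<omega>'] eq a b by simp
      then have "c = d"
        using a(2) b(2) unfolding rung_configs_iff by (meson PiE_ext)
      moreover have "transfer c f = transfer d g"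
        using seq_front[OF \<omega>, of k] seq_front[OF \<omega>', of k] eq k a b by simp
      ultimately show ?thesis using a b by simp
    qed
    moreover have "\<omega> \<in> {1..m} \<rightarrow>\<^sub>E front_states" "\<omega>' \<in> {1..m} \<rightarrow>\<^sub>E front_states"
      using \<omega> \<omega>' by (auto simp: admissible_seqs_def)
    ultimately show "\<omega> = \<omega>'" by (meson PiE_ext)
  qed simp
next
  fix \<omega> assume \<omega>: "\<omega> \<in> seqs m"
  have "fst (\<omega> k) x \<in> {1..out_degree (with_proj G) x + 2}" if "x \<in> pverts G" "k \<in> {1..m}" for x k
    using seqs_mem[OF \<omega> that(2)] that(1)
    by (elim front_statesE) (auto simp: rung_configs_iff PiE_iff)
  then have "config_of m \<omega> \<in> stable_configs G (slab G 1 m)"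
    by (auto simp: stable_configs_def config_of_rungs_def slab_def toppling_threshold_def)
  moreover have "live (front (config_of m \<omega>) 1 k)" if "k \<in> {1..m}" for k
    using seqs_mem[OF \<omega> that] seq_front[OF \<omega>, of k] that by (auto elim!: front_statesE)
  ultimately show "config_of m \<omega> \<in> Omega_L G 1 m"
    using Omega_L_iff_live[OF m] by blast
next
  fix \<eta> assume "\<eta> \<in> Omega_L G 1 m"
  then have stable: "\<eta> \<in> stable_configs G (slab G 1 m)"
    and live: "\<And>k. k \<in> {1..m} \<Longrightarrow> live (front \<eta> 1 k)"
    using Omega_L_iff_live[OF m] by auto
  define c where "c k = (\<lambda>x\<in>pverts G. \<eta> (x, k))" for k
  define \<omega> where "\<omega> = (\<lambda>k\<in>{1..m}. (c k, pverts G, front \<eta> 1 k))"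
  have front_c: "front \<eta> 1 k = transfer (c k) (front \<eta> 1 (k - 1))" if "1 \<le> k" for k
  proof -
    have "front \<eta> 1 k = transfer (\<lambda>x. \<eta> (x, k)) (front \<eta> 1 (k - 1))"
      using front_step[of 1 "k - 1" \<eta>] that by simp
    also have "\<dots> = transfer (c k) (front \<eta> 1 (k - 1))"
      by (rule transfer_cong) (simp add: c_def)
    finally show ?thesis .
  qed
  have c: "c k \<in> rung_configs G" if k: "k \<in> {1..m}" for k
  proof (rule rung_configsI)
    show "c k \<in> (\<Pi>\<^sub>E x\<in>pverts G. {1..out_degree (with_proj G) x + 2})"
      using stable k by (auto simp: c_def stable_configs_def slab_def PiE_iff toppling_threshold_def)
    show "live (transfer (c k) (front \<eta> 1 (k - 1)))"
      using live[OF k] front_c k by simp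
    show "front \<eta> 1 (k - 1) Y \<subseteq> pverts G" if "Y \<subseteq> pverts G" for Y
      using that k fire_bounds(2)[of 1 "k - 1" \<eta> Y] by (auto simp: front_def rung_def left_half_def)
  qed
  have first: "(c 1, pverts G, front \<eta> 1 1) = start_state (c 1)"
    using front_c[of 1] front_initial[of \<eta> 1] by (simp add: start_state_def)
  \<comment> \<open>Liveness of the fronts of \<eta> is exactly the side condition of
    \<open>front_states.step\<close>.\<close>
  have states: "(c k, pverts G, front \<eta> 1 k) \<in> front_states" if "1 \<le> k" "k \<le> m" for k
    using that
  proof (induction k rule: int_ge_induct)
    case base
    then show ?case unfolding first using c by (intro front_states.start) simp
  next
    case (step k)
    then have "(c k, pverts G, front \<eta> 1 k) \<in> front_states" by simp
    then show ?case
      using front_states.step[of _ "c (k + 1)"] c[of "k + 1"] live[of "k + 1"] front_c[of "k + 1"] step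
      by fastforce
  qed
  have "\<omega> \<in> seqs m"
    unfolding admissible_seqs_def
  proof (intro CollectI conjI ballI)
    show "\<omega> \<in> {1..m} \<rightarrow>\<^sub>E front_states" using states by (auto simp: \<omega>_def)
    show "\<omega> 1 \<in> start_state ` rung_configs G" using m c[of 1] by (simp add: \<omega>_def first)
    show "front_matrix (\<omega> k) (\<omega> (k + 1)) = 1" if "k \<in> {1..m - 1}" for k
      using that front_c[of "k + 1"] by (simp add: \<omega>_def front_matrix_def)
  qed
  moreover have "\<eta> = config_of m \<omega>"
  proof (rule PiE_ext)
    show "\<eta> \<in> slab G 1 m \<rightarrow>\<^sub>E UNIV" "config_of m \<omega> \<in> slab G 1 m \<rightarrow>\<^sub>E UNIV"
      using stable by (auto simp: stable_configs_def config_of_rungs_def PiE_iff)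
    show "\<eta> u = config_of m \<omega> u" if "u \<in> slab G 1 m" for u
      using that by (auto simp: config_of_rungs_def \<omega>_def c_def slab_def)
  qed
  ultimately show "\<exists>\<omega>\<in>seqs m. \<eta> = config_of m \<omega>" by blast
qed

end

theorem theorem15:
  fixes G :: "'a pair_pre_digraph"
  assumes "pair_graph G" and "connected (with_proj G)"
  shows "\<exists>(A :: 'a state set) (\<iota> :: ('a \<Rightarrow> nat) \<Rightarrow> 'a state) (T :: 'a state \<Rightarrow> 'a state \<Rightarrow> nat).
           A \<subseteq> states G \<and>
           \<iota> \<in> rung_configs G \<rightarrow> states G \<and> inj_on \<iota> (rung_configs G) \<and>
           zero_one_matrix A T \<and> transitive_matrix A T \<and>
           (\<forall>m\<ge>1. bij_betw (\<lambda>\<omega>. config_of_rungs G m (\<lambda>k. fst (\<omega> k)))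
                     (admissible_seqs A (\<iota> ` rung_configs G) T m) (Omega_L G 1 m))"
proof -
  interpret connected_pair_graph G
    using assms by (simp add: connected_pair_graph_def connected_pair_graph_axioms_def)
  show ?thesis
  proof (intro exI conjI allI impI)
    show "front_states \<subseteq> states G" by (rule front_states_subset)
    show "start_state \<in> rung_configs G \<rightarrow> states G"
      using front_states.start front_states_subset by blast
    show "inj_on start_state (rung_configs G)"
      by (simp add: inj_on_def start_state_def)
    show "zero_one_matrix front_states front_matrix"
      by (simp add: zero_one_matrix_def front_matrix_def)
    show "transitive_matrix front_states front_matrix"
      by (rule transitive_front_matrix)
  qed (rule bij_betw_config_of)
qed

end
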